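(* Let $\phi$ be a permutation (bijection) of $\mathcal{C}_n$. If $\phi$ is an $n$-isometry, then $\phi$ permutes the pairs $\{\overline{c},\overline{1}+\overline{c}\}$, $\overline{c}\in\mathcal{C}_n$ (that is, $\phi$ maps each such pair onto such a pair). Conversely, every permutation of $\mathcal{C}_n$ that permutes these pairs is an $n$-isometry.
   Context: $\mathcal{C}_n=\{0,1\}^n$ is the Boolean cube with Hamming distance $d$ and component-wise addition modulo $2$; $\overline{1}=(1,\ldots,1)$. An $n$-isometry is a bijection $\phi$ of $\mathcal{C}_n$ such that $d(\phi(x),\phi(y))=n$ whenever $d(x,y)=n$. *)

theory Defs
  imports "HOL-Analysis.Finite_Cartesian_Product" "HOL-Library.Z2"
begin

text \<open>The cube of dimension \<open>n = CARD('n)\<close> is the whole type \<open>bit ^ 'n\<close>: addition in the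
  two-element field \<open>bit\<close> is addition modulo 2, and it is lifted componentwise to vectors.
  Hence \<open>bij\<close> on this type means being a permutation of the cube.\<close>

type_synonym 'n cube = "bit ^ 'n"

definition all_ones :: "'n::finite cube" where
  "all_ones = (\<chi> i. 1)"

definition hamming_dist :: "'n::finite cube \<Rightarrow> 'n cube \<Rightarrow> nat" where
  "hamming_dist x y = card {i. x $ i \<noteq> y $ i}"

definition n_isometry :: "('n::finite cube \<Rightarrow> 'n cube) \<Rightarrow> bool" where
  "n_isometry \<phi> \<longleftrightarrow> bij \<phi> \<and>
     (\<forall>x y. hamming_dist x y = CARD('n) \<longrightarrow> hamming_dist (\<phi> x) (\<phi> y) = CARD('n))"

definition antipodal_pairs :: "'n::finite cube set set" where
  "antipodal_pairs = {{c, all_ones + c} | c. True}"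

definition permutes_antipodal_pairs :: "('n::finite cube \<Rightarrow> 'n cube) \<Rightarrow> bool" where
  "permutes_antipodal_pairs \<phi> \<longleftrightarrow> (\<forall>P \<in> antipodal_pairs. \<phi> ` P \<in> antipodal_pairs)"

end

theory Submission
  imports Defs
begin

text \<open>Only complementary points are at the maximal distance \<open>CARD('n)\<close>, so the
  \<open>n\<close>-isometry condition says precisely that \<open>\<phi>\<close> commutes with complementation
  \<open>c \<mapsto> all_ones + c\<close> (\<open>hamming_dist_eq_CARD_iff\<close>). Such a map clearly sends antipodal pairs
  to antipodal pairs. Conversely, a map that preserves the pairs sends \<open>c\<close> and its complement
  into a common pair, and by injectivity to different members of it; these are complements of
  each other.\<close>

lemma hamming_dist_eq_CARD_iff:
  fixes x y :: "'n::finite cube"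
  shows "hamming_dist x y = CARD('n) \<longleftrightarrow> y = all_ones + x"
proof -
  have "hamming_dist x y = CARD('n) \<longleftrightarrow> {i. x $ i \<noteq> y $ i} = UNIV"
    unfolding hamming_dist_def
    using card_subset_eq [OF finite subset_UNIV, of "{i. x $ i \<noteq> y $ i}"] by auto
  also have "\<dots> \<longleftrightarrow> (\<forall>i. x $ i \<noteq> y $ i)"
    by auto
  also have "\<dots> \<longleftrightarrow> (\<forall>i. y $ i = 1 + x $ i)"
  proof -
    have "a \<noteq> b \<longleftrightarrow> b = 1 + a" for a b :: bit
      by (cases a; cases b) simp_all
    then show ?thesis by blast
  qed
  also have "\<dots> \<longleftrightarrow> y = all_ones + x"
    by (simp add: all_ones_def vec_eq_iff)
  finally show ?thesis .
qed

lemma complement_neq: "all_ones + c \<noteq> (c :: 'n::finite cube)"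
  by (simp add: all_ones_def vec_eq_iff)

lemma complement_complement: "all_ones + (all_ones + c) = (c :: 'n::finite cube)"
  by (simp add: all_ones_def vec_eq_iff flip: add.assoc)

lemma complement_in_antipodal_pair:
  assumes "P \<in> antipodal_pairs" "x \<in> P" "y \<in> P" "x \<noteq> y"
  shows "y = all_ones + x"
  using assms unfolding antipodal_pairs_def by (auto simp: complement_complement)

lemma n_isometry_iff_commutes_with_complement:
  fixes \<phi> :: "'n::finite cube \<Rightarrow> 'n cube"
  assumes "bij \<phi>"
  shows "n_isometry \<phi> \<longleftrightarrow> (\<forall>c. \<phi> (all_ones + c) = all_ones + \<phi> c)"
  using assms unfolding n_isometry_def hamming_dist_eq_CARD_iff by blast

theorem theorem2:
  fixes \<phi> :: "'n::finite cube \<Rightarrow> 'n cube"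
  assumes "bij \<phi>"
  shows "(n_isometry \<phi> \<longrightarrow> permutes_antipodal_pairs \<phi>) \<and>
         (permutes_antipodal_pairs \<phi> \<longrightarrow> n_isometry \<phi>)"
proof (intro conjI impI)
  assume "n_isometry \<phi>"
  then have "\<phi> ` {c, all_ones + c} = {\<phi> c, all_ones + \<phi> c}" for c
    using n_isometry_iff_commutes_with_complement [OF assms] by simp
  then show "permutes_antipodal_pairs \<phi>"
    unfolding permutes_antipodal_pairs_def antipodal_pairs_def by blast
next
  assume pairs: "permutes_antipodal_pairs \<phi>"
  have "\<phi> (all_ones + c) = all_ones + \<phi> c" for c
  proof (rule complement_in_antipodal_pair)
    show "\<phi> ` {c, all_ones + c} \<in> antipodal_pairs"
      using pairs unfolding permutes_antipodal_pairs_def antipodal_pairs_def by blast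
    show "\<phi> c \<noteq> \<phi> (all_ones + c)"
      using bij_is_inj [OF assms] complement_neq by (metis injD)
  qed simp_all
  then show "n_isometry \<phi>"
    using n_isometry_iff_commutes_with_complement [OF assms] by blast
qed

end
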